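(* For every $n\in\mathbb{N}$, $$\sum_{k=0}^{2n}(-1)^k\tilde{G}_k\star\tilde{G}_{2n-k}=(-1)^n[2]_q^{2n}(xxyy)^n,$$ $$\sum_{k=0}^{2n}(-1)^kG_k\star G_{2n-k}=(-1)^n[2]_q^{2n}(yyxx)^n,$$ $$\sum_{k=0}^{2n}(-1)^kW_{-k}\star W_{k-2n}=(-1)^nq[2]_q^{2n+1}(xxyy)^nxx,$$ $$\sum_{k=0}^{2n}(-1)^kW_{k+1}\star W_{2n+1-k}=(-1)^nq[2]_q^{2n+1}(yyxx)^nyy.$$
   Context: Let $\mathbb{F}$ be a field of characteristic zero and let $q\in\mathbb{F}$ be nonzero and not a root of unity; $\mathbb{N}=\{0,1,2,\ldots\}$; $[2]_q=q+q^{-1}$. Let $\mathbb{V}$ be the free associative unital $\mathbb{F}$-algebra on two noncommuting generators (letters) $x,y$; the words in $x,y$ (including the trivial word $\mathbf{1}$) form a basis of $\mathbb{V}$. Words such as $(xxyy)^nx$ are written with respect to the free (concatenation) product. The $q$-shuffle product $\star$ on the vector space $\mathbb{V}$ is the bilinear associative product with unit $\mathbf{1}$ determined as follows. Put $\langle x,x\rangle=\langle y,y\rangle=2$ and $\langle x,y\rangle=\langle y,x\rangle=-2$. For nontrivial words $u=u_1\cdots u_r$ and $v=v_1\cdots v_s$, $$u\star v=u_1\big((u_2\cdots u_r)\star v\big)+v_1\big(u\star(v_2\cdots v_s)\big)q^{\langle v_1,u_1\rangle+\cdots+\langle v_1,u_r\rangle}.$$ The alternating words are, for $n\in\mathbb{N}$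 (powers in the free product): $\tilde{G}_{n+1}=(xy)^{n+1}$, $G_{n+1}=(yx)^{n+1}$, $W_{-n}=(xy)^nx$, $W_{n+1}=(yx)^ny$; also $G_0=\tilde{G}_0=\mathbf{1}$. *)

theory Defs
  imports Complex_Main "HOL-Library.Poly_Mapping"
begin

datatype letter = X | Y

datatype word = Word (letters: "letter list")

text \<open>Words form the free monoid, written additively as \<open>Poly_Mapping\<close> expects of its exponents.\<close>

instantiation word :: monoid_add
begin

definition zero_word :: word
  where "0 = Word []"

definition plus_word :: "word \<Rightarrow> word \<Rightarrow> word"
  where "u + v = Word (letters u @ letters v)"

instance
  by standard (simp_all add: zero_word_def plus_word_def)

end

text \<open>
  The free algebra is the monoid algebra of the free monoid: \<open>1\<close>, \<open>*\<close> and \<open>^\<close> from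
  \<open>Poly_Mapping\<close> are the trivial word, the free product and its powers.
\<close>

type_synonym 'a free_alg = "word \<Rightarrow>\<^sub>0 'a"

definition of_word :: "letter list \<Rightarrow> 'a::zero_neq_one free_alg"
  where "of_word w = Poly_Mapping.single (Word w) 1"

definition gen :: "letter \<Rightarrow> 'a::zero_neq_one free_alg"
  where "gen a = of_word [a]"

abbreviation gen_x :: "'a::zero_neq_one free_alg"  ("\<^bold>x") where "\<^bold>x \<equiv> gen X"
abbreviation gen_y :: "'a::zero_neq_one free_alg"  ("\<^bold>y") where "\<^bold>y \<equiv> gen Y"

definition scale :: "'a::mult_zero \<Rightarrow> 'a free_alg \<Rightarrow> 'a free_alg"  (infixr "*\<^sub>V" 72)
  where "c *\<^sub>V f = Poly_Mapping.map ((*) c) f"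

lemma lookup_scale [simp]:
  "Poly_Mapping.lookup (c *\<^sub>V f) w = c * Poly_Mapping.lookup f w"
  by (simp add: scale_def Poly_Mapping.map.rep_eq when_def)

lemma of_word_Nil: "of_word [] = (1 :: 'a::{zero_neq_one} free_alg)"
  by (simp add: of_word_def zero_word_def[symmetric])

lemma of_word_append: "of_word (u @ v) = (of_word u * of_word v :: 'a::comm_ring_1 free_alg)"
  by (simp add: of_word_def mult_single plus_word_def)

definition pairing :: "letter \<Rightarrow> letter \<Rightarrow> int"
  where "pairing a b = (if a = b then 2 else - 2)"

fun shuffle_words :: "'a::field \<Rightarrow> letter list \<Rightarrow> letter list \<Rightarrow> 'a free_alg" where
  "shuffle_words q [] v = of_word v"
| "shuffle_words q u [] = of_word u"
| "shuffle_words q (a # u) (b # v) =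
     gen a * shuffle_words q u (b # v)
     + (q powi (\<Sum>c\<leftarrow>a # u. pairing b c)) *\<^sub>V (gen b * shuffle_words q (a # u) v)"

text \<open>Bilinear extension of \<^const>\<open>shuffle_words\<close> from the basis of words.\<close>

definition qshuffle :: "'a::field free_alg \<Rightarrow> 'a \<Rightarrow> 'a free_alg \<Rightarrow> 'a free_alg"
    ("(_ \<star>\<^bsub>_\<^esub> _)" [71, 0, 71] 70)
  where "f \<star>\<^bsub>q\<^esub> g =
    (\<Sum>u\<in>Poly_Mapping.keys f. \<Sum>v\<in>Poly_Mapping.keys g.
       (Poly_Mapping.lookup f u * Poly_Mapping.lookup g v)
         *\<^sub>V shuffle_words q (letters u) (letters v))"

lemma qshuffle_of_word: "of_word u \<star>\<^bsub>q\<^esub> of_word v = shuffle_words q u v"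
  by (rule poly_mapping_eqI) (simp add: qshuffle_def of_word_def)

definition qtwo :: "'a::field \<Rightarrow> 'a"
  where "qtwo q = q + inverse q"

definition altGt :: "nat \<Rightarrow> 'a::field free_alg"
  where "altGt n = (\<^bold>x * \<^bold>y) ^ n"

definition altG :: "nat \<Rightarrow> 'a::field free_alg"
  where "altG n = (\<^bold>y * \<^bold>x) ^ n"

text \<open>
  The two families \<open>W\<^sub>-\<^sub>n = (xy)\<^sup>nx\<close> and \<open>W\<^sub>n\<^sub>+\<^sub>1 = (yx)\<^sup>ny\<close> (\<open>n \<in> \<nat>\<close>) together form one family
  indexed by the integers.
\<close>

definition altW :: "int \<Rightarrow> 'a::field free_alg"
  where "altW i = (if i \<le> 0 then (\<^bold>x * \<^bold>y) ^ nat (- i) * \<^bold>x else (\<^bold>y * \<^bold>x) ^ nat (i - 1) * \<^bold>y)"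

end

theory Submission
  imports Defs
begin

text \<open>
  Stripping the first letter of each shuffle turns the alternating convolutions of the words
  \<open>(ab)\<^sup>i\<close> and \<open>b(ab)\<^sup>i\<close> into one another. With \<open>A\<close>, \<open>C\<close> the convolutions of these two families with
  themselves, the mixed contributions telescope away and leave
  \<open>A\<^sub>m\<^sub>+\<^sub>2 = -(1 + q\<^sup>-\<^sup>2) aa C\<^sub>m\<close> and \<open>C\<^sub>m = (1 + q\<^sup>2) bb A\<^sub>m\<close>,
  where \<open>(1 + q\<^sup>-\<^sup>2) (1 + q\<^sup>2) = [2]\<^sub>q\<^sup>2\<close>. All four identities follow by iteration, the letters
  \<open>a\<close>, \<open>b\<close> being \<open>x\<close>, \<open>y\<close> in either order.
\<close>

lemma scale_add_right: "c *\<^sub>V (f + g) = c *\<^sub>V f + c *\<^sub>V (g :: 'a::comm_ring_1 free_alg)"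
  by (rule poly_mapping_eqI) (simp add: lookup_add algebra_simps)

lemma scale_add_left: "(c + d) *\<^sub>V f = c *\<^sub>V f + d *\<^sub>V (f :: 'a::comm_ring_1 free_alg)"
  by (rule poly_mapping_eqI) (simp add: lookup_add algebra_simps)

lemma scale_minus_left: "(- c) *\<^sub>V f = - (c *\<^sub>V (f :: 'a::comm_ring_1 free_alg))"
  by (rule poly_mapping_eqI) simp

lemma scale_zero_right [simp]: "c *\<^sub>V 0 = (0 :: 'a::comm_ring_1 free_alg)"
  by (rule poly_mapping_eqI) simp

lemma scale_one_left [simp]: "1 *\<^sub>V f = (f :: 'a::comm_ring_1 free_alg)"
  by (rule poly_mapping_eqI) simp

lemma scale_scale: "c *\<^sub>V d *\<^sub>V f = (c * d) *\<^sub>V (f :: 'a::comm_ring_1 free_alg)"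
  by (rule poly_mapping_eqI) (simp add: mult.assoc)

lemma scale_eq_mult: "c *\<^sub>V f = Poly_Mapping.single 0 c * (f :: 'a::comm_ring_1 free_alg)"
  by (simp add: scale_def mult_map_scale_conv_mult)

text \<open>Although the free product is noncommutative, \<open>single 0 c\<close> is central: its
  exponent is the neutral word, and coefficients commute. Centrality is checked monomial by
  monomial.\<close>

lemma mult_scale_right: "f * (c *\<^sub>V g) = c *\<^sub>V (f * (g :: 'a::comm_ring_1 free_alg))"
proof -
  have "f * Poly_Mapping.single 0 c = Poly_Mapping.single 0 c * f"
  proof (induction f rule: update_induct)
    case const
    then show ?case by simp
  next
    case (update f w b)
    have "Poly_Mapping.update w b f = f + Poly_Mapping.single w b"
      using update(1)
      by (intro poly_mapping_eqI)
        (auto simp: lookup_update lookup_add lookup_single in_keys_iff when_def)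
    with update(3) show ?case
      by (simp add: distrib_left distrib_right mult_single mult.commute)
  qed
  then show ?thesis
    by (simp add: scale_eq_mult flip: mult.assoc)
qed

text \<open>Reconciles the signs of the theorem, which are scalars, with those of
  \<open>alt_conv\<close>, which are elements of the algebra.\<close>

lemma neg_one_power_scale: "(-1) ^ k *\<^sub>V f = (-1) ^ k * (f :: 'a::comm_ring_1 free_alg)"
  by (cases "even k") (simp_all add: scale_minus_left)

definition alt_conv :: "(nat \<Rightarrow> nat \<Rightarrow> 'b::ring_1) \<Rightarrow> nat \<Rightarrow> 'b"
  where "alt_conv h m = (\<Sum>i\<le>m. (-1) ^ i * h i (m - i))"

lemma alt_conv_add: "alt_conv (\<lambda>i j. f i j + g i j) m = alt_conv f m + alt_conv g m"
  by (simp add: alt_conv_def distrib_left sum.distrib)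

lemma alt_conv_mult_left: "alt_conv (\<lambda>i j. c * h i j) m = c * alt_conv h m"
proof -
  have "(-1) ^ i * (c * h i j) = c * ((-1) ^ i * h i j)" for i j
    by (cases "even i") simp_all
  then show ?thesis
    by (simp add: alt_conv_def sum_distrib_left)
qed

lemma alt_conv_scale:
  "alt_conv (\<lambda>i j. c *\<^sub>V h i j) m = c *\<^sub>V (alt_conv h m :: 'a::comm_ring_1 free_alg)"
  by (simp add: scale_eq_mult alt_conv_mult_left)

text \<open>The term \<open>i = 0\<close> vanishes, and lowering the first index flips every sign.
  Lowering the second index, as in \<open>alt_conv_shift_right\<close>, flips none. The later
  cancellations rest on this asymmetry.\<close>

lemma alt_conv_shift_left:
  "alt_conv (\<lambda>i j. case i of 0 \<Rightarrow> 0 | Suc i' \<Rightarrow> h i' j) (Suc m) = - alt_conv h m"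
  unfolding alt_conv_def by (subst sum.atMost_Suc_shift) (simp add: sum_negf)

lemma alt_conv_shift_right:
  "alt_conv (\<lambda>i j. case j of 0 \<Rightarrow> 0 | Suc j' \<Rightarrow> h i j') (Suc m) = alt_conv h m"
  unfolding alt_conv_def by (simp add: Suc_diff_le)

lemma of_word_Cons: "of_word (a # w) = gen a * (of_word w :: 'a::comm_ring_1 free_alg)"
  using of_word_append[of "[a]" w] by (simp add: gen_def)

text \<open>Alternating words as lists, the form on which \<open>shuffle_words\<close>
  recurses.\<close>

fun alt_word :: "letter \<Rightarrow> letter \<Rightarrow> nat \<Rightarrow> letter list" where
  "alt_word a b 0 = []"
| "alt_word a b (Suc n) = a # b # alt_word a b n"

lemma of_word_alt_word: "of_word (alt_word a b n) = ((gen a * gen b) ^ n :: 'a::comm_ring_1 free_alg)"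
  by (induction n) (simp_all add: of_word_Nil of_word_Cons mult.assoc)

lemma mult_power_mult: "(u * v) ^ n * u = u * (v * u) ^ n" for u v :: "'b::monoid_mult"
  by (induction n) (simp_all add: mult.assoc)

lemma of_word_Cons_alt_word:
  "of_word (b # alt_word a b n) = ((gen b * gen a) ^ n * gen b :: 'a::comm_ring_1 free_alg)"
  by (simp add: of_word_Cons of_word_alt_word mult_power_mult)

locale letter_pair =
  fixes q :: "'a::field" and a b :: letter
  assumes q_nonzero: "q \<noteq> 0" and distinct_letters: "a \<noteq> b"
begin

abbreviation ev :: "nat \<Rightarrow> letter list"
  where "ev \<equiv> alt_word a b"

abbreviation od :: "nat \<Rightarrow> letter list"
  where "od i \<equiv> b # ev i"

lemma pairing_simps [simp]:
  "pairing a a = 2" "pairing b b = 2" "pairing a b = -2" "pairing b a = -2"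
  using distinct_letters by (auto simp: pairing_def)

text \<open>Each block \<open>ab\<close> contributes 2 - 2. Hence a letter passes
  \<open>ev i\<close> without a power of \<open>q\<close>, and passes \<open>od i\<close> with the
  exponent given by its leading \<open>b\<close> alone.\<close>

lemma sum_pairing_ev [simp]: "(\<Sum>c\<leftarrow>ev i. pairing a c) = 0" "(\<Sum>c\<leftarrow>ev i. pairing b c) = 0"
  by (induction i) simp_all

lemma shuffle_Nil_right [simp]: "shuffle_words q u [] = of_word u"
  by (cases u) simp_all

definition conv_ee :: "nat \<Rightarrow> 'a free_alg"
  where "conv_ee = alt_conv (\<lambda>i j. shuffle_words q (ev i) (ev j))"

definition conv_eo :: "nat \<Rightarrow> 'a free_alg"
  where "conv_eo = alt_conv (\<lambda>i j. shuffle_words q (ev i) (od j))"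

definition conv_oe :: "nat \<Rightarrow> 'a free_alg"
  where "conv_oe = alt_conv (\<lambda>i j. shuffle_words q (od i) (ev j))"

definition conv_oo :: "nat \<Rightarrow> 'a free_alg"
  where "conv_oo = alt_conv (\<lambda>i j. shuffle_words q (od i) (od j))"

lemma conv_ee_0: "conv_ee 0 = 1"
  by (simp add: conv_ee_def alt_conv_def of_word_Nil)

text \<open>Every nontrivial \<open>ev\<close> starts with \<open>a\<close>, and deleting that
  letter leaves an \<open>od\<close>. The minus sign comes from lowering the first index.\<close>

lemma conv_ee_Suc: "conv_ee (Suc m) = gen a * (conv_eo m - conv_oe m)"
proof -
  have split: "shuffle_words q (ev i) (ev j) =
      gen a * ((case i of 0 \<Rightarrow> 0 | Suc i' \<Rightarrow> shuffle_words q (od i') (ev j))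
             + (case j of 0 \<Rightarrow> 0 | Suc j' \<Rightarrow> shuffle_words q (ev i) (od j')))"
    \<comment> \<open>At \<open>i = j = 0\<close> the shuffle is 1 while the right side is 0; the
      indices in \<open>conv_ee (Suc m)\<close> never both vanish.\<close>
    if "i + j > 0" for i j
    using that
    by (cases i; cases j) (simp_all add: of_word_Cons distrib_left)
  have "conv_ee (Suc m) = alt_conv (\<lambda>i j.
      gen a * ((case i of 0 \<Rightarrow> 0 | Suc i' \<Rightarrow> shuffle_words q (od i') (ev j))
             + (case j of 0 \<Rightarrow> 0 | Suc j' \<Rightarrow> shuffle_words q (ev i) (od j')))) (Suc m)"
    unfolding conv_ee_def alt_conv_def
    by (intro sum.cong refl arg_cong2[where f = "(*)"] split) auto
  then show ?thesis
    by (simp add: alt_conv_mult_left alt_conv_add alt_conv_shift_left alt_conv_shift_right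
        conv_eo_def conv_oe_def del: shuffle_words.simps)
qed

lemma shuffle_ev_od: "shuffle_words q (ev i) (od j) =
    gen a * (case i of 0 \<Rightarrow> 0 | Suc i' \<Rightarrow> shuffle_words q (od i') (od j))
    + gen b * shuffle_words q (ev i) (ev j)"
  by (cases i) (simp_all add: of_word_Cons)

lemma shuffle_od_ev: "shuffle_words q (od i) (ev j) =
    gen b * shuffle_words q (ev i) (ev j)
    + (q powi (-2)) *\<^sub>V (gen a * (case j of 0 \<Rightarrow> 0 | Suc j' \<Rightarrow> shuffle_words q (od i) (od j')))"
  by (cases j) (simp_all add: of_word_Cons)

lemma shuffle_od_od: "shuffle_words q (od i) (od j) =
    gen b * (shuffle_words q (ev i) (od j) + q\<^sup>2 *\<^sub>V shuffle_words q (od i) (ev j))"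
  by (simp add: distrib_left mult_scale_right)

lemma conv_eo_Suc: "conv_eo (Suc m) = gen b * conv_ee (Suc m) - gen a * conv_oo m"
  unfolding conv_eo_def shuffle_ev_od
  by (simp add: alt_conv_mult_left alt_conv_add alt_conv_shift_left conv_ee_def conv_oo_def
      del: shuffle_words.simps)

lemma conv_oe_Suc:
  "conv_oe (Suc m) = gen b * conv_ee (Suc m) + (q powi (-2)) *\<^sub>V (gen a * conv_oo m)"
  unfolding conv_oe_def shuffle_od_ev
  by (simp add: alt_conv_mult_left alt_conv_add alt_conv_scale alt_conv_shift_right
      conv_ee_def conv_oo_def del: shuffle_words.simps)

lemma conv_oo: "conv_oo m = gen b * (conv_eo m + q\<^sup>2 *\<^sub>V conv_oe m)"
  unfolding conv_oo_def shuffle_od_od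
  by (simp add: alt_conv_mult_left alt_conv_add alt_conv_scale conv_eo_def conv_oe_def
      del: shuffle_words.simps)

lemma conv_eo_0: "conv_eo 0 = gen b" and conv_oe_0: "conv_oe 0 = gen b"
  by (simp_all add: conv_eo_def conv_oe_def alt_conv_def gen_def)

text \<open>In \<open>conv_eo m + q\<^sup>2 *\<^sub>V conv_oe m\<close> the two terms starting with
  \<open>a\<close> have opposite signs and weights 1 and \<open>q\<^sup>2 * q powi (-2)\<close>, so
  they cancel.\<close>

lemma conv_oo_conv_ee: "conv_oo m = (1 + q\<^sup>2) *\<^sub>V (gen b * gen b * conv_ee m)"
proof (cases m)
  case 0
  then show ?thesis
    by (simp add: conv_oo conv_eo_0 conv_oe_0 conv_ee_0 scale_add_left distrib_left
        mult_scale_right)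
next
  case (Suc k)
  have "q\<^sup>2 * q powi (-2) = 1"
    using q_nonzero by (simp add: power_int_minus)
  then show ?thesis
    unfolding Suc conv_oo[of "Suc k"] conv_eo_Suc conv_oe_Suc
    by (simp add: scale_add_left scale_add_right scale_scale mult_scale_right algebra_simps)
qed

text \<open>In the difference of \<open>conv_eo\<close> and \<open>conv_oe\<close> it is the terms
  starting with \<open>b\<close> that cancel.\<close>

lemma conv_ee_Suc_Suc:
  "conv_ee (Suc (Suc m)) = - ((1 + q powi (-2)) *\<^sub>V (gen a * gen a * conv_oo m))"
  unfolding conv_ee_Suc[of "Suc m"] conv_eo_Suc conv_oe_Suc
  by (simp add: scale_add_left scale_add_right mult_scale_right algebra_simps)

lemma conv_ee_even: "conv_ee (2 * n) =
    ((-1) ^ n * qtwo q ^ (2 * n)) *\<^sub>V (gen a * gen a * gen b * gen b) ^ n"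
proof (induction n)
  case 0
  then show ?case
    by (simp add: conv_ee_0)
next
  case (Suc n)
  have c: "(1 + q powi (-2)) * (1 + q\<^sup>2) = (qtwo q)\<^sup>2"
    using q_nonzero by (simp add: qtwo_def power_int_minus field_simps power2_eq_square)
  have "conv_ee (2 * Suc n) =
      (- (qtwo q)\<^sup>2) *\<^sub>V (gen a * gen a * gen b * gen b * conv_ee (2 * n))"
    using conv_ee_Suc_Suc[of "2 * n"]
    by (simp add: conv_oo_conv_ee mult_scale_right scale_scale c scale_minus_left mult.assoc)
  also have "\<dots> = ((-1) ^ Suc n * qtwo q ^ (2 * Suc n)) *\<^sub>V
      (gen a * gen a * gen b * gen b) ^ Suc n"
    by (simp add: Suc.IH mult_scale_right scale_scale power2_eq_square mult.assoc mult.left_commute)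
  finally show ?case .
qed

lemma conv_oo_even: "conv_oo (2 * n) =
    ((-1) ^ n * q * qtwo q ^ (2 * n + 1)) *\<^sub>V
      ((gen b * gen b * gen a * gen a) ^ n * gen b * gen b)"
proof -
  \<comment> \<open>This is the extra factor by which the W identities differ from the G
    identities.\<close>
  have c: "1 + q\<^sup>2 = q * qtwo q"
    using q_nonzero by (simp add: qtwo_def field_simps power2_eq_square)
  have "gen b * gen b * (gen a * gen a * gen b * gen b) ^ n
      = (gen b * gen b * gen a * gen a) ^ n * gen b * (gen b :: 'a free_alg)"
    using mult_power_mult[of "gen b * gen b" "gen a * gen a :: 'a free_alg" n]
    by (simp add: mult.assoc)
  then show ?thesis
    unfolding conv_oo_conv_ee conv_ee_even c mult_scale_right scale_scale
    by (simp add: ac_simps)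
qed

lemma sum_ev:
  "(\<Sum>k=0..2*n. (-1) ^ k *\<^sub>V (((gen a * gen b) ^ k) \<star>\<^bsub>q\<^esub> ((gen a * gen b) ^ (2*n - k)))) =
    ((-1) ^ n * qtwo q ^ (2*n)) *\<^sub>V (gen a * gen a * gen b * gen b) ^ n"
  unfolding conv_ee_even[symmetric]
  by (simp add: conv_ee_def alt_conv_def atLeast0AtMost neg_one_power_scale qshuffle_of_word
      flip: of_word_alt_word)

lemma sum_od:
  "(\<Sum>k=0..2*n. (-1) ^ k *\<^sub>V
      (((gen b * gen a) ^ k * gen b) \<star>\<^bsub>q\<^esub> ((gen b * gen a) ^ (2*n - k) * gen b))) =
    ((-1) ^ n * q * qtwo q ^ (2*n + 1)) *\<^sub>V
      ((gen b * gen b * gen a * gen a) ^ n * gen b * gen b)"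
  unfolding conv_oo_even[symmetric]
  by (simp add: conv_oo_def alt_conv_def atLeast0AtMost neg_one_power_scale qshuffle_of_word
      flip: of_word_Cons_alt_word)

end

theorem proposition5p3:
  fixes q :: "'a::field_char_0" and n :: nat
  assumes "q \<noteq> 0"
    and "\<forall>m::nat. m > 0 \<longrightarrow> q ^ m \<noteq> 1"
  shows "(\<Sum>k=0..2*n. (-1) ^ k *\<^sub>V (altGt k \<star>\<^bsub>q\<^esub> altGt (2*n - k)))
           = ((-1) ^ n * qtwo q ^ (2*n)) *\<^sub>V (\<^bold>x * \<^bold>x * \<^bold>y * \<^bold>y) ^ n
       \<and> (\<Sum>k=0..2*n. (-1) ^ k *\<^sub>V (altG k \<star>\<^bsub>q\<^esub> altG (2*n - k)))
           = ((-1) ^ n * qtwo q ^ (2*n)) *\<^sub>V (\<^bold>y * \<^bold>y * \<^bold>x * \<^bold>x) ^ n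
       \<and> (\<Sum>k=0..2*n. (-1) ^ k *\<^sub>V (altW (- int k) \<star>\<^bsub>q\<^esub> altW (int k - 2 * int n)))
           = ((-1) ^ n * q * qtwo q ^ (2*n + 1)) *\<^sub>V ((\<^bold>x * \<^bold>x * \<^bold>y * \<^bold>y) ^ n * \<^bold>x * \<^bold>x)
       \<and> (\<Sum>k=0..2*n. (-1) ^ k *\<^sub>V (altW (int k + 1) \<star>\<^bsub>q\<^esub> altW (2 * int n + 1 - int k)))
           = ((-1) ^ n * q * qtwo q ^ (2*n + 1)) *\<^sub>V ((\<^bold>y * \<^bold>y * \<^bold>x * \<^bold>x) ^ n * \<^bold>y * \<^bold>y)"
proof -
  interpret xy: letter_pair q X Y
    using assms(1) by unfold_locales auto
  interpret yx: letter_pair q Y X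
    using assms(1) by unfold_locales auto
  have "altW (- int k) = ((\<^bold>x * \<^bold>y) ^ k * \<^bold>x :: 'a free_alg)"
    and "altW (int k + 1) = ((\<^bold>y * \<^bold>x) ^ k * \<^bold>y :: 'a free_alg)" for k
    by (simp_all add: altW_def)
  moreover have "altW (int k - 2 * int n) = ((\<^bold>x * \<^bold>y) ^ (2 * n - k) * \<^bold>x :: 'a free_alg)"
    and "altW (2 * int n + 1 - int k) = ((\<^bold>y * \<^bold>x) ^ (2 * n - k) * \<^bold>y :: 'a free_alg)"
    if "k \<in> {0..2 * n}" for k
  proof -
    \<comment> \<open>The range of \<open>k\<close> keeps the natural subtraction from
      truncating.\<close>
    have "int k - 2 * int n = - int (2 * n - k)" "2 * int n + 1 - int k = int (2 * n - k) + 1"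
      using that by auto
    then show "altW (int k - 2 * int n) = ((\<^bold>x * \<^bold>y) ^ (2 * n - k) * \<^bold>x :: 'a free_alg)"
      and "altW (2 * int n + 1 - int k) = ((\<^bold>y * \<^bold>x) ^ (2 * n - k) * \<^bold>y :: 'a free_alg)"
      by (simp_all only: calculation)
  qed
  ultimately show ?thesis
    \<comment> \<open>The words \<open>od\<close> start with the second letter of the pair, so
      \<open>yx\<close> yields the identity for the words starting with \<open>x\<close>, and
      \<open>xy\<close> the one for those starting with \<open>y\<close>.\<close>
    using xy.sum_ev[of n] yx.sum_ev[of n] yx.sum_od[of n] xy.sum_od[of n]
    by (simp add: altGt_def altG_def cong: sum.cong_simp)
qed

end
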